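(* Let $p$ be a positive integer, let $a_0,a_1,\dots,a_{p-1}$ be integers, and let $c,z(0),z(1),\dots,z(p-1)$ be nonzero complex numbers. Let $z(s)$, $s=0,1,2,\dots$, be the sequence with initial values $z(0),\dots,z(p-1)$ determined by the nonlinear recursion of order $p$ $$z(s+p)=c\prod_{\ell=0}^{p-1}[z(s+\ell)]^{a_\ell},\qquad s=0,1,2,\dots$$ Let $y_0,\dots,y_{p-1}\in\mathbb{C}$ be the $p$ roots of the polynomial equation $$y^{p}-\sum_{\ell=0}^{p-1}a_\ell\,y^{\ell}=0,$$ and assume that they are all different and that $\sum_{\ell=0}^{p-1}a_\ell\neq 1$. Then for all $s=0,1,2,\dots$ $$z(s)=c^{\gamma(s)}\prod_{\ell=0}^{p-1}[z(\ell)]^{\alpha_\ell(s)},$$ where the exponents $\gamma(s)$ and $\alpha_n(s)$, $n=0,1,\dots,p-1$, are the solutions of the linear recursions (for $s=0,1,2,\dots$) $$\alpha_n(s+p)=\sum_{\ell=0}^{p-1}a_\ell\,\alpha_n(s+\ell),\qquad \gamma(s+p)=1+\sum_{\ell=0}^{p-1}a_\ell\,\gamma(s+\ell),$$ with initial conditions $$\alpha_n(s)=\delta_{ns},\qquad \gamma(s)=0,\qquad n,s=0,1,\dots,p-1 .$$ Moreover, these exponents are given for all $s=0,1,2,\dots$ by the explicit formulas $$\alpha_n(s)=\sum_{\ell=0}^{p-1}A_{n\ell}\,(y_\ell)^{s},\qquad n=0,1,\dots,p-1,$$ $$\gamma(s)=\Big[1-\sum_{\ell=0}^{p-1}a_\ell\Big]^{-1}+\sum_{\ell=0}^{p-1}C_\ell\,(y_\ell)^{s},$$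 where the $p^2$ ($s$-independent) parameters $A_{n\ell}$ and the $p$ ($s$-independent) parameters $C_\ell$ are determined by the following systems of linear algebraic equations, which are solvable: $$\sum_{\ell=0}^{p-1}A_{n\ell}\,(y_\ell)^{s}=\delta_{ns},\qquad n,s=0,1,\dots,p-1,$$ $$\sum_{\ell=0}^{p-1}C_\ell\,(y_\ell)^{s}=-\Big[1-\sum_{\ell=0}^{p-1}a_\ell\Big]^{-1},\qquad s=0,1,\dots,p-1.$$
   Context: $\delta_{ns}$ is the Kronecker symbol: $\delta_{ns}=1$ if $n=s$ and $0$ otherwise. Powers are integer powers with the convention $x^0=1$ (including $0^0=1$). The integers $a_\ell$ may be positive, negative or zero. *)

theory Defs
  imports Complex_Main "HOL-Library.FuncSet"
begin

text \<open>
  Finite families indexed by 0, ..., p - 1 are functions on \<^typ>\<open>nat\<close> whose values are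
  only used below p. The exponents are integers, since the recursions have integer
  coefficients and integer initial values; this makes integer powers of complex numbers
  (\<open>powi\<close>) applicable to them.
\<close>

definition kronecker :: "nat \<Rightarrow> nat \<Rightarrow> 'a::zero_neq_one" where
  "kronecker n s = (if n = s then 1 else 0)"

definition is_alpha :: "nat \<Rightarrow> (nat \<Rightarrow> int) \<Rightarrow> nat \<Rightarrow> (nat \<Rightarrow> int) \<Rightarrow> bool" where
  "is_alpha p a n \<alpha> \<longleftrightarrow>
     (\<forall>s<p. \<alpha> s = kronecker n s) \<and>
     (\<forall>s. \<alpha> (s + p) = (\<Sum>l<p. a l * \<alpha> (s + l)))"

definition is_gamma :: "nat \<Rightarrow> (nat \<Rightarrow> int) \<Rightarrow> (nat \<Rightarrow> int) \<Rightarrow> bool" where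
  "is_gamma p a \<gamma> \<longleftrightarrow>
     (\<forall>s<p. \<gamma> s = 0) \<and>
     (\<forall>s. \<gamma> (s + p) = 1 + (\<Sum>l<p. a l * \<gamma> (s + l)))"

definition solves_A_system :: "nat \<Rightarrow> (nat \<Rightarrow> complex) \<Rightarrow> nat \<Rightarrow> (nat \<Rightarrow> complex) \<Rightarrow> bool" where
  "solves_A_system p y n A \<longleftrightarrow>
     (\<forall>s<p. (\<Sum>l<p. A l * y l ^ s) = kronecker n s)"

definition solves_C_system ::
  "nat \<Rightarrow> (nat \<Rightarrow> int) \<Rightarrow> (nat \<Rightarrow> complex) \<Rightarrow> (nat \<Rightarrow> complex) \<Rightarrow> bool" where
  "solves_C_system p a y C \<longleftrightarrow>
     (\<forall>s<p. (\<Sum>l<p. C l * y l ^ s) = - inverse (1 - (\<Sum>l<p. of_int (a l))))"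

end

theory Submission
  imports Defs "HOL-Computational_Algebra.Polynomial"
begin

text \<open>
  Taking logarithms formally, the monomial recursion for \<open>z\<close> becomes an affine recursion for the
  exponents of \<open>c\<close> and of the initial values. No logarithm is needed to make this rigorous: the
  representation of \<open>z\<close> follows by induction, since substituting it for \<open>z(s), \<dots>, z(s+p-1)\<close> in the
  recursion and collecting integer powers produces exactly the recursions of \<open>\<gamma>\<close> and
  \<open>\<alpha>\<^sub>n\<close> (lemma \<open>monomial_recursion_solution\<close>).

  A root \<open>y\<close> of the characteristic equation gives a solution \<open>y\<^sup>s\<close> of the homogeneous
  recursion, and the constant \<open>K = 1 / (1 - \<Sum> a\<^sub>l)\<close> is a fixed point of the recursion of
  \<open>\<gamma>\<close>. A recursion of order \<open>p\<close> is determined by its first \<open>p\<close> values, so each explicit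
  formula only has to be arranged to hold for \<open>s < p\<close>, and this is what the linear
  systems for \<open>A\<close> and \<open>C\<close> say. Both systems have the transposed Vandermonde matrix of the
  distinct nodes \<open>y\<^sub>l\<close>; the coefficients of the Lagrange basis polynomials form its
  inverse (lemma \<open>transposed_vandermonde_iff\<close>).
\<close>

section \<open>Recursions of order p\<close>

lemma order_p_induct [consumes 1, case_names init step]:
  fixes p :: nat
  assumes "p > 0"
    and init: "\<And>s. s < p \<Longrightarrow> P s"
    and step: "\<And>s. (\<And>l. l < p \<Longrightarrow> P (s + l)) \<Longrightarrow> P (s + p)"
  shows "P s"
proof (induction s rule: less_induct)
  case (less s)
  show ?case
  proof (cases "s < p")
    case False
    have "P (s - p + p)"
      by (rule step, rule less) (use False in auto)
    with False show ?thesis by simp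
  qed (rule init)
qed

lemma affine_recursion_unique:
  fixes u v :: "nat \<Rightarrow> 'a::comm_ring_1"
  assumes "p > 0"
    and "\<And>s. s < p \<Longrightarrow> u s = v s"
    and "\<And>s. u (s + p) = b + (\<Sum>l<p. a l * u (s + l))"
    and "\<And>s. v (s + p) = b + (\<Sum>l<p. a l * v (s + l))"
  shows "u s = v s"
  using assms(1)
proof (induction s rule: order_p_induct)
  case (step s)
  then show ?case by (simp add: assms(3,4))
qed (rule assms(2))

text \<open>
  Termination rests on the bound \<open>l < p\<close> of the summation index, which the congruence rule
  hands to the recursive call.
\<close>

context
  notes sum.cong [fundef_cong]
begin

function affine_seq ::
  "nat \<Rightarrow> (nat \<Rightarrow> 'a::comm_ring_1) \<Rightarrow> 'a \<Rightarrow> (nat \<Rightarrow> 'a) \<Rightarrow> nat \<Rightarrow> 'a" where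
  "affine_seq p a b i s =
     (if s < p then i s
      else b + (\<Sum>l<p. a l * affine_seq p a b i (s - p + l)))"
  by pat_completeness auto
termination
  by (relation "measure (\<lambda>(p, a, b, i, s). s)") auto

end

declare affine_seq.simps [simp del]

lemma affine_recursion_ex1:
  fixes a i :: "nat \<Rightarrow> 'a::comm_ring_1"
  assumes "p > 0"
  shows "\<exists>!u. (\<forall>s<p. u s = i s) \<and> (\<forall>s. u (s + p) = b + (\<Sum>l<p. a l * u (s + l)))"
proof (rule ex1I)
  show sol: "(\<forall>s<p. affine_seq p a b i s = i s) \<and>
        (\<forall>s. affine_seq p a b i (s + p) = b + (\<Sum>l<p. a l * affine_seq p a b i (s + l)))"
    (is "?sol (affine_seq p a b i)")
    using assms by (intro conjI allI impI; subst affine_seq.simps; simp)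
  show "u = affine_seq p a b i" if "?sol u" for u
    by (rule ext, rule affine_recursion_unique[OF assms]) (use that sol in auto)
qed

section \<open>Solving the transposed Vandermonde system\<close>

definition lagrange_basis :: "nat \<Rightarrow> (nat \<Rightarrow> 'a::field) \<Rightarrow> nat \<Rightarrow> 'a poly" where
  "lagrange_basis p y m =
     (\<Prod>l\<in>{..<p} - {m}. smult (inverse (y m - y l)) [:- y l, 1:])"

lemma poly_lagrange_basis:
  assumes "inj_on y {..<p}" "m < p" "l < p"
  shows "poly (lagrange_basis p y m) (y l) = (if l = m then 1 else 0)"
proof -
  have factor: "poly (smult (inverse (y m - y k)) [:- y k, 1:]) x = (x - y k) / (y m - y k)" for k x
    by (simp add: divide_inverse algebra_simps)
  have "y m - y k \<noteq> 0" if "k \<in> {..<p} - {m}" for k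
    using assms that by (auto dest: inj_onD)
  then show ?thesis
    unfolding lagrange_basis_def poly_prod factor
    using assms by (auto intro!: prod.neutral prod_zero)
qed

lemma degree_lagrange_basis:
  assumes "m < p"
  shows "degree (lagrange_basis p y m) < p"
proof -
  have "degree (lagrange_basis p y m)
      \<le> (\<Sum>l\<in>{..<p} - {m}. degree (smult (inverse (y m - y l)) [:- y l, 1:]))"
    unfolding lagrange_basis_def by (rule order_trans[OF degree_prod_sum_le]) (simp_all add: o_def)
  also have "\<dots> \<le> (\<Sum>l\<in>{..<p} - {m}. 1)"
    by (intro sum_mono) simp
  also have "\<dots> < p"
    using assms by simp
  finally show ?thesis .
qed

lemma lagrange_interpolation:
  fixes q :: "'a::field poly"
  assumes inj: "inj_on y {..<p}" and deg: "degree q < p"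
  shows "q = (\<Sum>m<p. smult (poly q (y m)) (lagrange_basis p y m))"
proof (rule poly_eqI_degree[where A = "y ` {..<p}"])
  have "degree (smult (poly q (y m)) (lagrange_basis p y m)) \<le> p - 1" if "m < p" for m
    using degree_lagrange_basis[OF that, of y] degree_smult_le[of "poly q (y m)" "lagrange_basis p y m"]
    by linarith
  then have "degree (\<Sum>m<p. smult (poly q (y m)) (lagrange_basis p y m)) \<le> p - 1"
    by (intro degree_sum_le) auto
  with deg show "degree (\<Sum>m<p. smult (poly q (y m)) (lagrange_basis p y m)) < card (y ` {..<p})"
    by (simp add: card_image[OF inj])
  show "degree q < card (y ` {..<p})"
    using deg by (simp add: card_image[OF inj])
qed (auto simp: poly_sum poly_lagrange_basis[OF inj] if_distrib cong: if_cong)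

text \<open>
  The row sums \<open>\<Sum>\<^sub>l A\<^sub>l y\<^sub>l\<^sup>s\<close> for \<open>s < p\<close> give the value of the functional
  \<open>q \<mapsto> \<Sum>\<^sub>l A\<^sub>l q(y\<^sub>l)\<close> on every polynomial of degree below \<open>p\<close>; evaluating it at a Lagrange
  basis polynomial isolates one \<open>A\<^sub>m\<close>. Conversely, interpolating the
  monomial of exponent \<open>s\<close> shows that the values so obtained solve the system.
\<close>
lemma transposed_vandermonde_iff:
  fixes y g A :: "nat \<Rightarrow> 'a::field"
  assumes inj: "inj_on y {..<p}"
  shows "(\<forall>s<p. (\<Sum>l<p. A l * y l ^ s) = g s) \<longleftrightarrow>
         (\<forall>m<p. A m = (\<Sum>t<p. coeff (lagrange_basis p y m) t * g t))"
proof (intro iffI allI impI)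
  fix m assume sys: "\<forall>s<p. (\<Sum>l<p. A l * y l ^ s) = g s" and m: "m < p"
  have eval: "poly (lagrange_basis p y m) x = (\<Sum>t<p. coeff (lagrange_basis p y m) t * x ^ t)" for x
    unfolding poly_altdef using degree_lagrange_basis[OF m, of y]
    by (intro sum.mono_neutral_left) (auto simp: coeff_eq_0)
  have "A m = (\<Sum>l<p. A l * poly (lagrange_basis p y m) (y l))"
    using m by (simp add: poly_lagrange_basis[OF inj m] if_distrib cong: if_cong)
  also have "\<dots> = (\<Sum>l<p. \<Sum>t<p. coeff (lagrange_basis p y m) t * (A l * y l ^ t))"
    by (simp add: eval sum_distrib_left mult_ac)
  also have "\<dots> = (\<Sum>t<p. coeff (lagrange_basis p y m) t * (\<Sum>l<p. A l * y l ^ t))"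
    by (subst sum.swap) (simp add: sum_distrib_left)
  finally show "A m = (\<Sum>t<p. coeff (lagrange_basis p y m) t * g t)"
    using sys by simp
next
  fix s assume A: "\<forall>m<p. A m = (\<Sum>t<p. coeff (lagrange_basis p y m) t * g t)" and s: "s < p"
  have "monom 1 s = (\<Sum>m<p. smult (y m ^ s) (lagrange_basis p y m))"
    using lagrange_interpolation[OF inj, of "monom 1 s"] s
    by (simp add: degree_monom_eq poly_monom)
  then have "coeff (monom 1 s) t = (\<Sum>m<p. y m ^ s * coeff (lagrange_basis p y m) t)" for t
    by (simp add: coeff_sum)
  then have mon: "(\<Sum>m<p. y m ^ s * coeff (lagrange_basis p y m) t) = (if t = s then 1 else 0)" for t
    by (metis coeff_monom)
  have "(\<Sum>l<p. A l * y l ^ s) = (\<Sum>l<p. \<Sum>t<p. y l ^ s * coeff (lagrange_basis p y l) t * g t)"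
    using A by (simp add: sum_distrib_right sum_distrib_left mult_ac)
  also have "\<dots> = (\<Sum>t<p. (if t = s then 1 else 0) * g t)"
    by (subst sum.swap) (simp add: mon flip: sum_distrib_right)
  also have "\<dots> = g s"
    using s by (simp add: if_distrib[of "\<lambda>x. x * _"] cong: if_cong)
  finally show "(\<Sum>l<p. A l * y l ^ s) = g s" .
qed

text \<open>
  The systems determine only the values below \<open>p\<close>, hence the restriction to extensional
  functions.
\<close>
lemma transposed_vandermonde_ex1:
  fixes y g :: "nat \<Rightarrow> 'a::field"
  assumes "inj_on y {..<p}"
  shows "\<exists>!A. A \<in> extensional {..<p} \<and> (\<forall>s<p. (\<Sum>l<p. A l * y l ^ s) = g s)"
  unfolding transposed_vandermonde_iff[OF assms]
proof (rule ex1I)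
  let ?B = "restrict (\<lambda>m. \<Sum>t<p. coeff (lagrange_basis p y m) t * g t) {..<p}"
  show "?B \<in> extensional {..<p} \<and>
        (\<forall>m<p. ?B m = (\<Sum>t<p. coeff (lagrange_basis p y m) t * g t))"
    by simp
  show "A = ?B" if "A \<in> extensional {..<p} \<and>
        (\<forall>m<p. A m = (\<Sum>t<p. coeff (lagrange_basis p y m) t * g t))" for A
    using that by (intro extensionalityI[of A "{..<p}"]) auto
qed

section \<open>Explicit solutions from the characteristic roots\<close>

lemma exponential_sum_recursion:
  fixes y A a :: "nat \<Rightarrow> 'a::comm_ring_1"
  assumes root: "\<And>m. m < q \<Longrightarrow> y m ^ p = (\<Sum>l<p. a l * y m ^ l)"
  shows "(\<Sum>m<q. A m * y m ^ (s + p)) = (\<Sum>l<p. a l * (\<Sum>m<q. A m * y m ^ (s + l)))"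
proof -
  have "(\<Sum>m<q. A m * y m ^ (s + p)) = (\<Sum>m<q. \<Sum>l<p. a l * (A m * y m ^ (s + l)))"
    by (intro sum.cong refl) (simp add: power_add root sum_distrib_left mult_ac)
  also have "\<dots> = (\<Sum>l<p. a l * (\<Sum>m<q. A m * y m ^ (s + l)))"
    by (subst sum.swap) (simp add: sum_distrib_left)
  finally show ?thesis .
qed

text \<open>
  The hypothesis on \<open>K\<close> says that the constant sequence \<open>K\<close> solves the recursion; it is
  met by \<open>K = 0\<close> in the homogeneous case.
\<close>
lemma affine_recursion_explicit:
  fixes y A a :: "nat \<Rightarrow> 'a::comm_ring_1"
  assumes "p > 0"
    and root: "\<And>m. m < q \<Longrightarrow> y m ^ p = (\<Sum>l<p. a l * y m ^ l)"
    and fixpoint: "K = b + (\<Sum>l<p. a l) * K"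
    and init: "\<And>s. s < p \<Longrightarrow> u s = K + (\<Sum>m<q. A m * y m ^ s)"
    and rec: "\<And>s. u (s + p) = b + (\<Sum>l<p. a l * u (s + l))"
  shows "u s = K + (\<Sum>m<q. A m * y m ^ s)"
  using \<open>p > 0\<close> init rec
proof (rule affine_recursion_unique)
  fix s
  have "K + (\<Sum>m<q. A m * y m ^ (s + p))
      = b + (\<Sum>l<p. a l) * K + (\<Sum>l<p. a l * (\<Sum>m<q. A m * y m ^ (s + l)))"
    using exponential_sum_recursion[of q y p a A s] root by (simp flip: fixpoint)
  also have "\<dots> = b + (\<Sum>l<p. a l * (K + (\<Sum>m<q. A m * y m ^ (s + l))))"
    by (simp add: distrib_left sum.distrib sum_distrib_right add.assoc)
  finally show "K + (\<Sum>m<q. A m * y m ^ (s + p))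
      = b + (\<Sum>l<p. a l * (K + (\<Sum>m<q. A m * y m ^ (s + l))))" .
qed

section \<open>The monomial recursion\<close>

lemma power_int_sum:
  fixes x :: "'a::field"
  assumes "x \<noteq> 0"
  shows "x powi (\<Sum>i\<in>I. f i) = (\<Prod>i\<in>I. x powi f i)"
  by (induction I rule: infinite_finite_induct) (simp_all add: power_int_add assms)

lemma prod_power_int:
  fixes f :: "'b \<Rightarrow> 'a::field"
  shows "(\<Prod>i\<in>I. f i) powi n = (\<Prod>i\<in>I. f i powi n)"
  by (induction I rule: infinite_finite_induct) (simp_all add: power_int_mult_distrib)

lemma monomial_recursion_solution:
  fixes z :: "nat \<Rightarrow> 'a::field"
  assumes "p > 0" and c: "c \<noteq> 0"
    and z: "\<And>s. s < p \<Longrightarrow> z s \<noteq> 0"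
    and rec: "\<And>s. z (s + p) = c * (\<Prod>l<p. z (s + l) powi a l)"
    and \<alpha>: "\<And>n. n < p \<Longrightarrow> is_alpha p a n (\<alpha> n)"
    and \<gamma>: "is_gamma p a \<gamma>"
  shows "z s = c powi \<gamma> s * (\<Prod>n<p. z n powi \<alpha> n s)"
  using \<open>p > 0\<close>
proof (induction s rule: order_p_induct)
  case (init s)
  have "(\<Prod>n<p. z n powi \<alpha> n s) = (\<Prod>n<p. if n = s then z n else 1)"
    using init \<alpha> by (intro prod.cong) (auto simp: is_alpha_def kronecker_def)
  with init \<gamma> show ?case by (simp add: is_gamma_def)
next
  case (step s)
  have \<gamma>_rec: "c powi \<gamma> (s + p) = c * (\<Prod>l<p. c powi (a l * \<gamma> (s + l)))"
    using \<gamma> c by (simp add: is_gamma_def power_int_add power_int_sum)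
  have \<alpha>_rec: "z n powi \<alpha> n (s + p) = (\<Prod>l<p. z n powi (a l * \<alpha> n (s + l)))" if "n < p" for n
    using \<alpha>[OF that] z[OF that] by (simp add: is_alpha_def power_int_sum)
  have "z (s + p) = c * (\<Prod>l<p. (c powi \<gamma> (s + l) * (\<Prod>n<p. z n powi \<alpha> n (s + l))) powi a l)"
    using step by (simp add: rec)
  also have "\<dots> = c * (\<Prod>l<p. c powi (a l * \<gamma> (s + l)))
      * (\<Prod>l<p. \<Prod>n<p. z n powi (a l * \<alpha> n (s + l)))"
    by (simp add: power_int_mult_distrib prod_power_int prod.distrib mult_ac
        flip: power_int_mult)
  also have "(\<Prod>l<p. \<Prod>n<p. z n powi (a l * \<alpha> n (s + l))) = (\<Prod>n<p. z n powi \<alpha> n (s + p))"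
    by (subst prod.swap) (simp add: \<alpha>_rec)
  finally show ?case by (simp add: \<gamma>_rec)
qed

section \<open>The solution of the nonlinear recursion\<close>

theorem mainTheorem3:
  fixes p :: nat and a :: "nat \<Rightarrow> int" and c :: complex
    and z y :: "nat \<Rightarrow> complex"
  assumes "p > 0"
    and "c \<noteq> 0"
    and "\<forall>s<p. z s \<noteq> 0"
    and "\<forall>s. z (s + p) = c * (\<Prod>l<p. z (s + l) powi a l)"
    and "y ` {..<p} = {x. x ^ p - (\<Sum>l<p. of_int (a l) * x ^ l) = 0}"
    and "inj_on y {..<p}"
    and "(\<Sum>l<p. a l) \<noteq> 1"
  shows
    "(\<forall>n<p. \<exists>!\<alpha>. is_alpha p a n \<alpha>) \<and>
     (\<exists>!\<gamma>. is_gamma p a \<gamma>) \<and>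
     (\<forall>n<p. \<exists>!A. A \<in> extensional {..<p} \<and> solves_A_system p y n A) \<and>
     (\<exists>!C. C \<in> extensional {..<p} \<and> solves_C_system p a y C) \<and>
     (\<forall>\<alpha> \<gamma>. (\<forall>n<p. is_alpha p a n (\<alpha> n)) \<and> is_gamma p a \<gamma> \<longrightarrow>
        (\<forall>s. z s = c powi \<gamma> s * (\<Prod>l<p. z l powi \<alpha> l s)) \<and>
        (\<forall>A. (\<forall>n<p. solves_A_system p y n (A n)) \<longrightarrow>
           (\<forall>n<p. \<forall>s. of_int (\<alpha> n s) = (\<Sum>l<p. A n l * y l ^ s))) \<and>
        (\<forall>C. solves_C_system p a y C \<longrightarrow>
           (\<forall>s. of_int (\<gamma> s) =
              inverse (1 - (\<Sum>l<p. of_int (a l))) + (\<Sum>l<p. C l * y l ^ s))))"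
proof (intro conjI allI impI)
  let ?K = "inverse (1 - (\<Sum>l<p. of_int (a l))) :: complex"
  note p = \<open>p > 0\<close> and inj = \<open>inj_on y {..<p}\<close>
  have root: "y m ^ p = (\<Sum>l<p. of_int (a l) * y m ^ l)" if "m < p" for m
  proof -
    have "y m \<in> y ` {..<p}" using that by simp
    then show ?thesis unfolding assms(5) by simp
  qed
  have "(\<Sum>l<p. of_int (a l)) \<noteq> (1 :: complex)"
    using \<open>(\<Sum>l<p. a l) \<noteq> 1\<close> by (metis of_int_eq_1_iff of_int_sum)
  then have K: "?K = 1 + (\<Sum>l<p. of_int (a l)) * ?K"
    by (simp add: field_simps)
  show "\<exists>!\<alpha>. is_alpha p a n \<alpha>" for n
    using affine_recursion_ex1[OF p, of "kronecker n" 0 a] by (simp add: is_alpha_def)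
  show "\<exists>!\<gamma>. is_gamma p a \<gamma>"
    using affine_recursion_ex1[OF p, of "\<lambda>_. 0" 1 a] by (simp add: is_gamma_def)
  show "\<exists>!A. A \<in> extensional {..<p} \<and> solves_A_system p y n A" for n
    unfolding solves_A_system_def by (rule transposed_vandermonde_ex1[OF inj])
  show "\<exists>!C. C \<in> extensional {..<p} \<and> solves_C_system p a y C"
    unfolding solves_C_system_def by (rule transposed_vandermonde_ex1[OF inj])
  fix \<alpha> \<gamma>
  assume exponents: "(\<forall>n<p. is_alpha p a n (\<alpha> n)) \<and> is_gamma p a \<gamma>"
  then have \<alpha>: "is_alpha p a n (\<alpha> n)" if "n < p" for n
    using that by simp
  from exponents have \<gamma>: "is_gamma p a \<gamma>" by simp
  show "z s = c powi \<gamma> s * (\<Prod>l<p. z l powi \<alpha> l s)" for s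
    by (rule monomial_recursion_solution[OF p \<open>c \<noteq> 0\<close> _ _ \<alpha> \<gamma>])
      (use assms(3,4) in simp_all)
  show "of_int (\<alpha> n s) = (\<Sum>l<p. A n l * y l ^ s)"
    if A: "\<forall>n<p. solves_A_system p y n (A n)" and n: "n < p" for A n s
  proof -
    have "of_int (\<alpha> n s) = 0 + (\<Sum>l<p. A n l * y l ^ s)"
    proof (rule affine_recursion_explicit[OF p root])
      show "of_int (\<alpha> n s) = 0 + (\<Sum>l<p. A n l * y l ^ s)" if "s < p" for s
        using A n \<alpha>[OF n] that by (simp add: is_alpha_def solves_A_system_def kronecker_def)
      show "of_int (\<alpha> n (s + p)) = 0 + (\<Sum>l<p. of_int (a l) * of_int (\<alpha> n (s + l)) :: complex)" for s
        using \<alpha>[OF n] by (simp add: is_alpha_def)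
    qed simp_all
    then show ?thesis by simp
  qed
  show "of_int (\<gamma> s) = ?K + (\<Sum>l<p. C l * y l ^ s)"
    if C: "solves_C_system p a y C" for C s
  proof (rule affine_recursion_explicit[OF p root K])
    show "of_int (\<gamma> s) = ?K + (\<Sum>l<p. C l * y l ^ s)" if "s < p" for s
      using C \<gamma> that by (simp add: is_gamma_def solves_C_system_def)
    show "of_int (\<gamma> (s + p)) = 1 + (\<Sum>l<p. of_int (a l) * of_int (\<gamma> (s + l)) :: complex)" for s
      using \<gamma> by (simp add: is_gamma_def)
  qed
qed

end
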